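(* Let $B\ge 2$ be an integer, and for $N\ge 1$ let $$P_{N,B}^{\pm}:=\sum_{j=1}^{N}\left(1-\frac1B\right)^{j-1}\mathrm{Prob}[t_{N,B}^{\pm}=j],$$ where $t_{N,B}^{+}$ and $t_{N,B}^{-}$ are the travel times beyond position $N$ of the chains $\mathcal{L}_B^+$ and $\mathcal{L}_B^-$. Then for fixed $B$, as $N\to\infty$, $$P_{N,B}^{\pm}=\exp\bigl(-\alpha_B^{\pm}N(1+o(1))\bigr),$$ where $\tfrac12\alpha_B^-$ is the unique (real) root $\alpha$ of $$\sum_{i=1}^{B-1}\exp(i\alpha)=B,$$ and $\tfrac12\alpha_B^+$ is the unique (real) root $\alpha$ of $$\sum_{i=1}^{B-1}\exp((i+1)\alpha)=B .$$ As $B\to\infty$ these quantities satisfy $$\alpha_B^+=\frac{4}{B^2}-\frac{20/3}{B^3}+O(B^{-4}),\qquad \alpha_B^-=\frac{4}{B^2}+\frac{4/3}{B^3}+O(B^{-4}).$$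
   Context: The chains $\mathcal{L}_B^-$ and $\mathcal{L}_B^+$ describe a leapfrog motion of a white and a black pebble on the line $\{0,1,2,\dots\}$; the state is the (signed) distance by which the white pebble is ahead of the black one. At each transition the pebble that is further behind jumps forward by $v$ units; if both pebbles are at the same position (state $0$), only the white pebble jumps. The jump sizes $v$ are independent of each other and of the current state, and: (i) in $\mathcal{L}_B^-$, $v$ is uniform on $\{1,2,\dots,B-1\}$; (ii) in $\mathcal{L}_B^+$, $v$ is uniform on $\{2,3,\dots,B\}$. The travel time $t_{N,B}^-$ (respectively $t_{N,B}^+$) beyond position $N$ is obtained by starting $\mathcal{L}_B^-$ (respectively $\mathcal{L}_B^+$) in state $0$ with both pebbles at position $0$, and counting the total number of transitions up to and including the first one at which a pebble is moved to a position exceeding $N$.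
   Formalization: The decay claim with the sum j=1..N is proved for B≥4 (minus) and B≥3 (plus); it is false for B=2 (both signs) and B=3 (minus), where P=0 for infinitely many N. For every B≥2 it is proved with the sum taken over all j≥1. *)

theory Defs
  imports "HOL-Probability.Probability" "HOL-Library.Landau_Symbols"
begin

text \<open>The state of the chain: the signed distance by which the white pebble (first component)
  is ahead of the black one (second component).\<close>

definition lead :: "nat \<times> nat \<Rightarrow> int" where
  "lead p = int (fst p) - int (snd p)"

text \<open>The pebble that is further behind jumps by \<open>v\<close>; in state 0 it is the white one.\<close>

definition leapfrog_step :: "nat \<Rightarrow> nat \<times> nat \<Rightarrow> nat \<times> nat" where
  "leapfrog_step v p = (if lead p \<le> 0 then (fst p + v, snd p) else (fst p, snd p + v))"

primrec pebbles :: "(nat \<Rightarrow> nat) \<Rightarrow> nat \<Rightarrow> nat \<times> nat" where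
  "pebbles v 0 = (0, 0)"
| "pebbles v (Suc n) = leapfrog_step (v n) (pebbles v n)"

text \<open>If no pebble ever passes \<open>N\<close> the value of \<open>LEAST\<close> is arbitrary; for jump sizes that are
  at least 1 this does not happen.\<close>

definition travel_time :: "nat \<Rightarrow> (nat \<Rightarrow> nat) \<Rightarrow> nat" where
  "travel_time N v = (LEAST n. fst (pebbles v n) > N \<or> snd (pebbles v n) > N)"

definition jumps :: "nat set \<Rightarrow> (nat \<Rightarrow> nat) measure" where
  "jumps V = (\<Pi>\<^sub>M n\<in>(UNIV :: nat set). measure_pmf (pmf_of_set V))"

definition travel_prob :: "nat set \<Rightarrow> nat \<Rightarrow> nat \<Rightarrow> real" where
  "travel_prob V N j = measure (jumps V) {v \<in> space (jumps V). travel_time N v = j}"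

definition jump_sizes_minus :: "nat \<Rightarrow> nat set" where
  "jump_sizes_minus B = {1..B - 1}"

definition jump_sizes_plus :: "nat \<Rightarrow> nat set" where
  "jump_sizes_plus B = {2..B}"

definition P_minus :: "nat \<Rightarrow> nat \<Rightarrow> real" where
  "P_minus B N = (\<Sum>j=1..N. (1 - 1 / real B) ^ (j - 1) * travel_prob (jump_sizes_minus B) N j)"

definition P_plus :: "nat \<Rightarrow> nat \<Rightarrow> real" where
  "P_plus B N = (\<Sum>j=1..N. (1 - 1 / real B) ^ (j - 1) * travel_prob (jump_sizes_plus B) N j)"

text \<open>The travel time counts the jumps of both pebbles, so it can be as large as \<open>2 * N + 1\<close>, and
  \<open>P_minus\<close>, \<open>P_plus\<close> omit its values above \<open>N\<close>; the following sums range over all values.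
  The omitted terms matter only for very small \<open>B\<close>: \<open>P_minus 2 N = 0\<close> for all \<open>N\<close>, and
  \<open>P_minus 3 N = P_plus 2 N = 0\<close> for all even \<open>N\<close>, since the travel time always exceeds \<open>N\<close> there.\<close>

definition P_minus_full :: "nat \<Rightarrow> nat \<Rightarrow> real" where
  "P_minus_full B N =
     (\<Sum>\<^sub>\<infinity>j\<in>{1..}. (1 - 1 / real B) ^ (j - 1) * travel_prob (jump_sizes_minus B) N j)"

definition P_plus_full :: "nat \<Rightarrow> nat \<Rightarrow> real" where
  "P_plus_full B N =
     (\<Sum>\<^sub>\<infinity>j\<in>{1..}. (1 - 1 / real B) ^ (j - 1) * travel_prob (jump_sizes_plus B) N j)"

definition is_root_minus :: "nat \<Rightarrow> real \<Rightarrow> bool" where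
  "is_root_minus B \<alpha> \<longleftrightarrow> (\<Sum>i=1..B - 1. exp (real i * \<alpha>)) = real B"

definition is_root_plus :: "nat \<Rightarrow> real \<Rightarrow> bool" where
  "is_root_plus B \<alpha> \<longleftrightarrow> (\<Sum>i=1..B - 1. exp ((real i + 1) * \<alpha>)) = real B"

definition alpha_minus :: "nat \<Rightarrow> real" where
  "alpha_minus B = 2 * (THE \<alpha>. is_root_minus B \<alpha>)"

definition alpha_plus :: "nat \<Rightarrow> real" where
  "alpha_plus B = 2 * (THE \<alpha>. is_root_plus B \<alpha>)"

text \<open>\<open>P N = exp (- a * N * (1 + o(1)))\<close> as \<open>N\<close> tends to infinity.\<close>

definition decays_at_rate :: "(nat \<Rightarrow> real) \<Rightarrow> real \<Rightarrow> bool" where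
  "decays_at_rate P a \<longleftrightarrow>
     (\<exists>\<epsilon> :: nat \<Rightarrow> real. \<epsilon> \<longlonglongrightarrow> 0 \<and>
        (\<forall>\<^sub>F N in sequentially. P N = exp (- a * real N * (1 + \<epsilon> N))))"

end

theory Submission
  imports Defs "HOL-Real_Asymp.Real_Asymp"
begin

text \<open>Put \<open>\<beta> = 1 - 1 / B\<close> and let \<open>x\<close> be the root in question. The defining equation says exactly
  that \<open>\<beta> * exp (x * v)\<close> has mean 1 for a random jump \<open>v\<close>, so \<open>\<beta> ^ n\<close> times \<open>exp\<close> of \<open>x\<close> times the
  sum of the two positions is a martingale. When a pebble first passes \<open>N\<close>, the other one is
  less than \<open>B\<close> behind \<open>N\<close>, so the sum of the positions is \<open>2 * N + O(1)\<close>; optional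
  stopping then gives \<open>E[\<beta> ^ t] = exp (- 2 * x * N + O(1))\<close>. Values of \<open>t\<close> above \<open>N\<close> contribute
  at most \<open>(N + 1) * \<beta> ^ N\<close>, which is negligible as soon as \<open>\<beta> < exp (- 2 * x)\<close>. The expansions
  in \<open>B\<close> follow by evaluating the increasing sum of exponentials at the claimed value of the root
  shifted by \<open>\<plusminus> 10 / B ^ 4\<close>.\<close>

subsection \<open>The root equations\<close>

text \<open>Half of the claimed rate is 2/B^2 + (2/3)/B^3, and the next coefficient of this root is
  10/9; for the plus chain it is 82/9. The shift 10 exceeds both, so all four comparisons hold for
  large B. They are the comparison of the exponential sum with B, multiplied by
  \<open>exp x - 1\<close>.\<close>

lemma minus_root_above:
  "\<forall>\<^sub>F B in sequentially. let x = 2 / real B ^ 2 + (2 / 3) / real B ^ 3 + 10 / real B ^ 4 in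
     real B * (exp x - 1) < exp (real B * x) - exp x"
  unfolding Let_def by real_asymp

text \<open>Positivity of x is included because multiplying by \<open>exp x - 1\<close> preserves
  the order only for x > 0; the shifted point above the root inherits it.\<close>

lemma minus_root_below:
  "\<forall>\<^sub>F B in sequentially. let x = 2 / real B ^ 2 + (2 / 3) / real B ^ 3 - 10 / real B ^ 4 in
     0 < x \<and> exp (real B * x) - exp x < real B * (exp x - 1)"
  unfolding Let_def by (intro eventually_conj; real_asymp)

lemma plus_root_above:
  "\<forall>\<^sub>F B in sequentially. let x = 2 / real B ^ 2 - (10 / 3) / real B ^ 3 + 10 / real B ^ 4 in
     real B * (exp x - 1) < exp x * (exp (real B * x) - exp x)"
  unfolding Let_def by real_asymp

lemma plus_root_below:
  "\<forall>\<^sub>F B in sequentially. let x = 2 / real B ^ 2 - (10 / 3) / real B ^ 3 - 10 / real B ^ 4 in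
     0 < x \<and> exp x * (exp (real B * x) - exp x) < real B * (exp x - 1)"
  unfolding Let_def by (intro eventually_conj; real_asymp)

text \<open>The parameter \<open>c\<close> treats both chains at once: 0 gives the equation for the
  minus chain, 1 the one for the plus chain.\<close>

definition expsum :: "real \<Rightarrow> nat \<Rightarrow> real \<Rightarrow> real" where
  "expsum c B x = (\<Sum>i=1..B - 1. exp ((real i + c) * x))"

lemma is_root_minus_iff: "is_root_minus B \<alpha> \<longleftrightarrow> expsum 0 B \<alpha> = B"
  by (simp add: is_root_minus_def expsum_def)

lemma is_root_plus_iff: "is_root_plus B \<alpha> \<longleftrightarrow> expsum 1 B \<alpha> = B"
  by (simp add: is_root_plus_def expsum_def)

lemma expsum_strict_mono:
  assumes "B \<ge> 2" "c \<ge> 0" "x < y"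
  shows "expsum c B x < expsum c B y"
  unfolding expsum_def by (rule sum_strict_mono) (use assms in auto)

lemma expsum_less_iff:
  assumes "B \<ge> 2" "c \<ge> 0"
  shows "expsum c B x < expsum c B y \<longleftrightarrow> x < y"
  by (rule strict_mono_less[OF strict_monoI]) (rule expsum_strict_mono[OF assms])

text \<open>Intermediate values on the interval from 0 to ln B: at 0 the sum is B - 1, and at ln B
  its first term alone is B^(1+c). Strict monotonicity gives uniqueness.\<close>

lemma expsum_root_ex1:
  assumes "B \<ge> 2" "c \<ge> 0"
  shows "\<exists>!\<alpha>. expsum c B \<alpha> = B"
proof -
  have B: "real B \<le> exp ((1 + c) * ln B)"
    using assms by (simp add: distrib_right exp_add)
  also have "\<dots> \<le> expsum c B (ln B)"
    unfolding expsum_def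
    using member_le_sum[of 1 "{1..B - 1}" "\<lambda>i. exp ((real i + c) * ln B)"] assms by simp
  finally have "real B \<le> expsum c B (ln B)" .
  moreover have "expsum c B 0 \<le> B"
    by (simp add: expsum_def)
  moreover have "0 \<le> ln (real B)"
    using assms by simp
  moreover have "continuous_on {0..ln B} (expsum c B)"
    unfolding expsum_def[abs_def] by (intro continuous_intros)
  ultimately obtain \<alpha> where \<alpha>: "expsum c B \<alpha> = B"
    using IVT'[of "expsum c B" 0 B "ln B"] by blast
  show ?thesis
  proof (rule ex1I, rule \<alpha>)
    show "y = \<alpha>" if "expsum c B y = B" for y
      using that \<alpha> expsum_strict_mono[OF assms, of y \<alpha>] expsum_strict_mono[OF assms, of \<alpha> y]
      by (metis less_irrefl linorder_less_linear)
  qed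
qed

definition expsum_root :: "real \<Rightarrow> nat \<Rightarrow> real" where
  "expsum_root c B = (THE \<alpha>. expsum c B \<alpha> = B)"

lemma expsum_root:
  assumes "B \<ge> 2" "c \<ge> 0"
  shows "expsum c B (expsum_root c B) = B"
  unfolding expsum_root_def by (rule theI'[OF expsum_root_ex1[OF assms]])

lemma alpha_minus_eq: "alpha_minus B = 2 * expsum_root 0 B"
  by (simp add: alpha_minus_def expsum_root_def is_root_minus_iff)

lemma alpha_plus_eq: "alpha_plus B = 2 * expsum_root 1 B"
  by (simp add: alpha_plus_def expsum_root_def is_root_plus_iff)

lemma expsum_root_less:
  assumes "B \<ge> 2" "c \<ge> 0" "expsum c B y > B"
  shows "expsum_root c B < y"
  using assms(3) unfolding expsum_root[OF assms(1,2), symmetric] expsum_less_iff[OF assms(1,2)] .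

lemma expsum_root_greater:
  assumes "B \<ge> 2" "c \<ge> 0" "expsum c B y < B"
  shows "y < expsum_root c B"
  using assms(3) unfolding expsum_root[OF assms(1,2), symmetric] expsum_less_iff[OF assms(1,2)] .

lemma expsum_root_pos:
  assumes "B \<ge> 2" "c \<ge> 0"
  shows "expsum_root c B > 0"
  by (rule expsum_root_greater[OF assms]) (use assms in \<open>simp add: expsum_def\<close>)

text \<open>A geometric sum with ratio \<open>exp x\<close>, kept free of division so that x = 0
  needs no exception.\<close>

lemma expsum_closed:
  assumes "B \<ge> 1"
  shows "(exp x - 1) * expsum c B x = exp (c * x) * (exp (real B * x) - exp x)"
  using assms
proof (induction B rule: dec_induct)
  case base
  show ?case by (simp add: expsum_def)
next
  case (step n)
  have "expsum c (Suc n) x = expsum c n x + exp ((real n + c) * x)"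
    unfolding expsum_def using step.hyps by (cases n) auto
  then have "(exp x - 1) * expsum c (Suc n) x =
      exp (c * x) * (exp (real n * x) - exp x) + (exp x - 1) * exp ((real n + c) * x)"
    using step.IH by (simp add: distrib_left)
  then show ?case by (simp add: exp_add algebra_simps)
qed

section \<open>Locating the roots for large B\<close>

lemma expsum_compare_iff:
  assumes "B \<ge> 1" "x > 0"
  shows "expsum c B x > B \<longleftrightarrow> exp (c * x) * (exp (real B * x) - exp x) > B * (exp x - 1)"
    and "expsum c B x < B \<longleftrightarrow> exp (c * x) * (exp (real B * x) - exp x) < B * (exp x - 1)"
  unfolding expsum_closed[OF assms(1), symmetric] using assms(2)
  by (simp_all add: mult.commute)

text \<open>Monotonicity of \<open>expsum\<close> traps the root within 10/B^4 of
  \<open>f B\<close>; the rates are twice the roots, hence the constant 20.\<close>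

lemma root_asymp:
  fixes f :: "nat \<Rightarrow> real"
  assumes "c \<ge> 0"
    and "\<forall>\<^sub>F B in sequentially. let x = f B + 10 / real B ^ 4 in
      real B * (exp x - 1) < exp (c * x) * (exp (real B * x) - exp x)"
    and "\<forall>\<^sub>F B in sequentially. let x = f B - 10 / real B ^ 4 in
      0 < x \<and> exp (c * x) * (exp (real B * x) - exp x) < real B * (exp x - 1)"
  shows "(\<lambda>B. 2 * expsum_root c B - 2 * f B) \<in> O(\<lambda>B. 1 / real B ^ 4)"
proof (rule bigoI[of _ 20])
  show "\<forall>\<^sub>F B in sequentially. norm (2 * expsum_root c B - 2 * f B) \<le> 20 * norm (1 / real B ^ 4)"
    using assms(2,3)[unfolded Let_def] eventually_ge_at_top[of 2]
  proof eventually_elim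
    case (elim B)
    have pos: "0 \<le> 10 / real B ^ 4" by simp
    have "expsum_root c B < f B + 10 / real B ^ 4"
      by (rule expsum_root_less) (use elim assms(1) pos in \<open>subst expsum_compare_iff | linarith\<close>)+
    moreover have "f B - 10 / real B ^ 4 < expsum_root c B"
      by (rule expsum_root_greater) (use elim assms(1) pos in \<open>subst expsum_compare_iff | linarith\<close>)+
    ultimately have "\<bar>expsum_root c B - f B\<bar> \<le> 10 / real B ^ 4" by linarith
    then show ?case by simp
  qed
qed

lemma alpha_minus_asymp:
  "(\<lambda>B. alpha_minus B - (4 / real B ^ 2 + (4 / 3) / real B ^ 3)) \<in> O(\<lambda>B. 1 / real B ^ 4)"
  using root_asymp[of 0 "\<lambda>B. 2 / real B ^ 2 + (2 / 3) / real B ^ 3"] minus_root_above minus_root_below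
  by (simp add: alpha_minus_eq Let_def)

lemma alpha_plus_asymp:
  "(\<lambda>B. alpha_plus B - (4 / real B ^ 2 - (20 / 3) / real B ^ 3)) \<in> O(\<lambda>B. 1 / real B ^ 4)"
  using root_asymp[of 1 "\<lambda>B. 2 / real B ^ 2 - (10 / 3) / real B ^ 3"] plus_root_above plus_root_below
  by (simp add: alpha_plus_eq Let_def)

subsection \<open>The leapfrog chain\<close>

definition crossed :: "nat \<Rightarrow> (nat \<Rightarrow> nat) \<Rightarrow> nat \<Rightarrow> bool" where
  "crossed N v n \<longleftrightarrow> fst (pebbles v n) > N \<or> snd (pebbles v n) > N"

text \<open>Unlike the single positions, this sum grows by \<open>v n\<close> whichever pebble
  jumps, so it is a random walk with independent increments.\<close>

definition total :: "(nat \<Rightarrow> nat) \<Rightarrow> nat \<Rightarrow> nat" where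
  "total v n = fst (pebbles v n) + snd (pebbles v n)"

lemma total_0 [simp]: "total v 0 = 0"
  by (simp add: total_def)

lemma total_Suc [simp]: "total v (Suc n) = total v n + v n"
  by (simp add: total_def leapfrog_step_def)

lemma not_crossed_0 [simp]: "\<not> crossed N v 0"
  by (simp add: crossed_def)

lemma crossed_Suc: "crossed N v n \<Longrightarrow> crossed N v (Suc n)"
  by (auto simp: crossed_def leapfrog_step_def)

lemma crossed_mono: "m \<le> n \<Longrightarrow> crossed N v m \<Longrightarrow> crossed N v n"
  by (induction rule: dec_induct) (auto intro: crossed_Suc)

lemma total_ge:
  assumes "\<And>i. v i \<ge> 1"
  shows "total v n \<ge> n"
proof (induction n)
  case (Suc n)
  then show ?case using assms[of n] by simp
qed simp

text \<open>Each jump adds at least 1, so after 2N + 1 jumps the two positions cannot both be at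
  most N.\<close>

lemma crossed_late:
  assumes "\<And>i. v i \<ge> 1"
  shows "crossed N v (2 * N + 1)"
  using total_ge[of v "2 * N + 1", OF assms] by (auto simp: crossed_def total_def)

text \<open>Crossing is permanent, so being the first crossing time is a condition on two
  consecutive times only.\<close>

lemma travel_time_eq_Suc_iff:
  assumes "\<And>i. v i \<ge> 1"
  shows "travel_time N v = Suc n \<longleftrightarrow> \<not> crossed N v n \<and> crossed N v (Suc n)"
proof -
  have tt: "travel_time N v = (LEAST n. crossed N v n)"
    by (simp add: travel_time_def crossed_def)
  have ex: "crossed N v (LEAST n. crossed N v n)"
    using crossed_late[OF assms] by (rule LeastI)
  show ?thesis
  proof
    assume "travel_time N v = Suc n"
    then show "\<not> crossed N v n \<and> crossed N v (Suc n)"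
      using ex not_less_Least[of n "crossed N v"] by (simp add: tt)
  next
    assume *: "\<not> crossed N v n \<and> crossed N v (Suc n)"
    show "travel_time N v = Suc n" unfolding tt
    proof (rule Least_equality)
      show "Suc n \<le> m" if "crossed N v m" for m
        using that * crossed_mono[of m n N v] by (cases "m \<le> n") auto
    qed (use * in auto)
  qed
qed

lemma travel_time_bounds:
  assumes "\<And>i. v i \<ge> 1"
  shows "travel_time N v \<in> {1..2 * N + 1}"
proof -
  have tt: "travel_time N v = (LEAST n. crossed N v n)"
    by (simp add: travel_time_def crossed_def)
  have "crossed N v (travel_time N v)" "travel_time N v \<le> 2 * N + 1"
    using crossed_late[of v N, OF assms] by (auto simp: tt intro: LeastI Least_le)
  moreover from this(1) have "travel_time N v \<noteq> 0"
    by (metis not_crossed_0)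
  ultimately show ?thesis by simp
qed

text \<open>Before the jump both pebbles are at most N, which gives the upper bound. For the lower
  one, the jumping pebble was not ahead of the other and lands beyond N, so the other one is already
  beyond N - b.\<close>

lemma total_at_crossing:
  assumes "\<not> crossed N v n" "crossed N v (Suc n)" "v n \<le> b"
  shows "total v (Suc n) \<le> 2 * N + b" "2 * N \<le> total v (Suc n) + b"
  using assms
  by (auto simp: crossed_def total_def leapfrog_step_def lead_def split: if_splits)

section \<open>Measurability and independence\<close>

lemma pebbles_cong: "(\<And>i. i < n \<Longrightarrow> v i = w i) \<Longrightarrow> pebbles v n = pebbles w n"
  by (induction n) auto

text \<open>The index set is left general to serve both the full product space and the finite
  product over \<open>{..<n}\<close> in the independence argument.\<close>

lemma measurable_pebbles:
  assumes "{..<n} \<subseteq> I" and "\<And>i. sets (M i) = UNIV"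
  shows "(\<lambda>v. pebbles v n) \<in> measurable (PiM I M) (count_space UNIV)"
  using assms(1)
proof (induction n)
  case (Suc n)
  have [measurable]: "(\<lambda>v. pebbles v n) \<in> measurable (PiM I M) (count_space UNIV)"
    using Suc by (simp add: lessThan_Suc)
  have "n \<in> I" using Suc.prems by auto
  then have "(\<lambda>v. v n) \<in> measurable (PiM I M) (M n)"
    by (rule measurable_component_singleton)
  then have [measurable]: "(\<lambda>v. v n) \<in> measurable (PiM I M) (count_space UNIV)"
    by (subst measurable_cong_sets[OF refl, where N' = "M n"]) (auto simp: assms(2))
  show ?case
    unfolding pebbles.simps by measurable
qed simp

lemma prob_space_jumps: "prob_space (jumps V)"
  unfolding jumps_def by (rule prob_space_PiM) (rule measure_pmf.prob_space_axioms)

lemma integrable_jumps_bounded: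
  fixes f :: "(nat \<Rightarrow> nat) \<Rightarrow> real"
  assumes "AE v in jumps V. norm (f v) \<le> c" "f \<in> borel_measurable (jumps V)"
  shows "integrable (jumps V) f"
  using finite_measure.integrable_const_bound[OF prob_space.finite_measure[OF prob_space_jumps]] assms .

text \<open>The common setting of both chains, with \<beta> = 1 - 1/B. Here \<open>root\<close> is
  the mean-one condition multiplied by the number of jump sizes, and \<open>b\<close> is only an
  upper bound for the jumps, so that B serves for both chains.\<close>

locale leapfrog =
  fixes V :: "nat set" and b :: nat and \<beta> x :: real
  assumes finite_V: "finite V" and V_nonempty: "V \<noteq> {}" and V_le: "V \<subseteq> {1..b}"
    and \<beta>_pos: "0 < \<beta>" and \<beta>_less: "\<beta> < 1" and x_pos: "0 < x"
    and root: "\<beta> * (\<Sum>v\<in>V. exp (x * real v)) = real (card V)"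
begin

abbreviation "J \<equiv> jumps V"

text \<open>The product space contains all sequences of naturals, so facts about the jump sizes hold
  only almost surely.\<close>

lemma AE_jumps: "AE v in J. \<forall>i. v i \<in> V"
  unfolding AE_all_countable
proof
  fix i :: nat
  show "AE v in J. v i \<in> V"
    unfolding jumps_def
    by (rule AE_PiM_component)
       (auto simp: AE_measure_pmf_iff finite_V V_nonempty intro: measure_pmf.prob_space_axioms)
qed

lemma AE_bounds: "AE v in J. \<forall>i. 1 \<le> v i \<and> v i \<le> b"
  using AE_jumps by eventually_elim (use V_le in auto)

lemma measurable_pebbles_J [measurable]: "(\<lambda>v. pebbles v n) \<in> measurable J (count_space UNIV)"
  unfolding jumps_def by (rule measurable_pebbles) auto

lemma measurable_coord_J [measurable]: "(\<lambda>v. v n) \<in> measurable J (count_space UNIV)"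
proof -
  have "(\<lambda>v. v n) \<in> measurable J (measure_pmf (pmf_of_set V))"
    unfolding jumps_def by (rule measurable_component_singleton) auto
  then show ?thesis by simp
qed

lemma measurable_travel_time [measurable]: "travel_time N \<in> measurable J (count_space UNIV)"
  unfolding travel_time_def[abs_def] by measurable

lemma distr_coord: "distr J (count_space UNIV) (\<lambda>v. v n) = measure_pmf (pmf_of_set V)"
proof -
  have "distr J (measure_pmf (pmf_of_set V)) (\<lambda>v. v n) = measure_pmf (pmf_of_set V)"
    unfolding jumps_def by (rule distr_PiM_component) (auto intro: measure_pmf.prob_space_axioms)
  moreover have "distr J (count_space UNIV) (\<lambda>v. v n) = distr J (measure_pmf (pmf_of_set V)) (\<lambda>v. v n)"
    by (rule distr_cong) auto
  ultimately show ?thesis by simp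
qed

lemma integral_coord:
  "integrable J (\<lambda>v. g (v n) :: real)" "(\<integral>v. g (v n) \<partial>J) = (\<Sum>k\<in>V. g k) / card V"
proof -
  have "integrable (distr J (count_space UNIV) (\<lambda>v. v n)) g"
    unfolding distr_coord by (rule integrable_measure_pmf_finite) (simp add: finite_V V_nonempty)
  then show "integrable J (\<lambda>v. g (v n))"
    by (subst (asm) integrable_distr_eq) auto
  have "(\<integral>v. g (v n) \<partial>J) = integral\<^sup>L (distr J (count_space UNIV) (\<lambda>v. v n)) g"
    by (subst integral_distr) auto
  also have "\<dots> = (\<Sum>k\<in>V. g k) / card V"
    unfolding distr_coord using finite_V V_nonempty by (simp add: integral_pmf_of_set)
  finally show "(\<integral>v. g (v n) \<partial>J) = (\<Sum>k\<in>V. g k) / card V" .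
qed

text \<open>The pebbles after n jumps are a function of the coordinates below n, which are
  independent of coordinate n.\<close>

lemma indep_coord:
  fixes h :: "nat \<times> nat \<Rightarrow> real" and g :: "nat \<Rightarrow> real"
  shows "prob_space.indep_var J borel (\<lambda>v. h (pebbles v n)) borel (\<lambda>v. g (v n))"
proof -
  let ?D = "\<lambda>_::nat. count_space (UNIV :: nat set)"
  have "prob_space.indep_vars J ?D (\<lambda>i v. v i) UNIV"
  proof (subst prob_space.indep_vars_iff_distr_eq_PiM[OF prob_space_jumps])
    \<comment> \<open>The joint law of the coordinates is \<open>J\<close> itself, by construction
      the product of the marginal laws.\<close>
    have "distr J (PiM UNIV ?D) (\<lambda>v. \<lambda>i\<in>UNIV. v i) = distr J J (\<lambda>v. v)"
      by (rule distr_cong) (auto simp: jumps_def intro!: sets_PiM_cong)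
    also have "\<dots> = PiM UNIV (\<lambda>i. distr J (count_space UNIV) (\<lambda>v. v i))"
      by (simp add: distr_coord) (simp add: jumps_def)
    finally show "distr J (PiM UNIV ?D) (\<lambda>v. \<lambda>i\<in>UNIV. v i) =
      PiM UNIV (\<lambda>i. distr J (count_space UNIV) (\<lambda>v. v i))" .
  qed auto
  from prob_space.indep_var_restrict[OF prob_space_jumps this, of "{..<n}" "{n}"]
  have "prob_space.indep_var J (PiM {..<n} ?D) (\<lambda>v. restrict v {..<n}) (PiM {n} ?D) (\<lambda>v. restrict v {n})"
    by auto
  then have "prob_space.indep_var J borel ((\<lambda>v. h (pebbles v n)) \<circ> (\<lambda>v. restrict v {..<n}))
     borel ((\<lambda>v. g (v n)) \<circ> (\<lambda>v. restrict v {n}))"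
  proof (rule prob_space.indep_var_compose[OF prob_space_jumps])
    show "(\<lambda>v. h (pebbles v n)) \<in> borel_measurable (PiM {..<n} ?D)"
      by (rule measurable_compose[OF measurable_pebbles]) auto
    show "(\<lambda>v. g (v n)) \<in> borel_measurable (PiM {n} ?D)"
      by (rule measurable_compose[OF measurable_component_singleton]) auto
  qed
  moreover have "pebbles (restrict v {..<n}) n = pebbles v n" for v
    by (rule pebbles_cong) auto
  ultimately show ?thesis by (simp add: comp_def)
qed

section \<open>Optional stopping for the exponential martingale\<close>

definition alive :: "nat \<Rightarrow> nat \<Rightarrow> real" where
  "alive N n = (\<integral>v. (if crossed N v n then 0 else \<beta> ^ n * exp (x * total v n)) \<partial>J)"

text \<open>The martingale stopped at the travel time splits into \<open>alive\<close>, the paths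
  that have not crossed by time n, and the contributions \<open>stopped\<close> of the paths that
  cross exactly at each earlier or present time.\<close>

definition stopped :: "nat \<Rightarrow> nat \<Rightarrow> real" where
  "stopped N n = (\<integral>v. (if travel_time N v = n then \<beta> ^ n * exp (x * total v n) else 0) \<partial>J)"

lemma measurable_crossed [measurable]: "Measurable.pred J (\<lambda>v. crossed N v n)"
  unfolding crossed_def by measurable

lemma measurable_total [measurable]: "(\<lambda>v. total v n) \<in> measurable J (count_space UNIV)"
  unfolding total_def by (rule measurable_compose[OF measurable_pebbles_J]) auto

lemma integrable_alive:
  "integrable J (\<lambda>v. if crossed N v n then 0 else \<beta> ^ n * exp (x * total v n))"
proof (rule integrable_jumps_bounded)
  have "total v n \<le> 2 * N" if "\<not> crossed N v n" for v
    using that by (auto simp: total_def crossed_def)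
  then have "exp (x * total v n) \<le> exp (x * (2 * N))" if "\<not> crossed N v n" for v
    using x_pos that by (simp add: of_nat_mono) (metis of_nat_le_iff of_nat_mult of_nat_numeral)
  then show "AE v in J. norm (if crossed N v n then 0 else \<beta> ^ n * exp (x * total v n))
      \<le> \<beta> ^ n * exp (x * (2 * N))"
    using \<beta>_pos by (auto intro!: AE_I2)
qed measurable

lemma integrable_stopped:
  "integrable J (\<lambda>v. if travel_time N v = n then \<beta> ^ n * exp (x * total v n) else 0)"
proof (rule integrable_jumps_bounded)
  show "AE v in J. norm (if travel_time N v = n then \<beta> ^ n * exp (x * total v n) else 0)
      \<le> \<beta> ^ n * exp (x * (2 * N + b))"
    using AE_bounds
  proof eventually_elim
    case (elim v)
    then have v: "\<And>i. 1 \<le> v i" "\<And>i. v i \<le> b" by auto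
    have "total v n \<le> 2 * N + b" if n: "travel_time N v = n"
    proof (cases n)
      case (Suc m)
      then show ?thesis
        using n total_at_crossing(1)[of N v m b] travel_time_eq_Suc_iff[of v N m, OF v(1)] v(2) by auto
    qed simp
    then have "real (total v n) \<le> 2 * N + b" if n: "travel_time N v = n"
      using that by (metis of_nat_add of_nat_le_iff of_nat_mult of_nat_numeral)
    then show ?case using x_pos \<beta>_pos by auto
  qed
qed measurable

lemma alive_0: "alive N 0 = 1"
  using prob_space.prob_space[OF prob_space_jumps] by (simp add: alive_def)

text \<open>The process \<open>\<beta> ^ n * exp (x * total v n)\<close> is a martingale; this is one step of optional
  stopping.\<close>

lemma alive_step: "alive N n = alive N (Suc n) + stopped N (Suc n)"
proof -
  define h where "h = (\<lambda>p. if fst p > N \<or> snd p > N then 0 else \<beta> ^ n * exp (x * real (fst p + snd p)))"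
  have h: "h (pebbles v n) = (if crossed N v n then 0 else \<beta> ^ n * exp (x * total v n))" for v
    by (simp add: h_def crossed_def total_def)
  \<comment> \<open>\<open>h\<close> sees only the pebbles before the jump, so the factor of the new
    jump splits off by independence; it integrates to 1 by \<open>root\<close>.\<close>
  have "(\<integral>v. h (pebbles v n) * (\<beta> * exp (x * v n)) \<partial>J) =
      (\<integral>v. h (pebbles v n) \<partial>J) * (\<integral>v. \<beta> * exp (x * v n) \<partial>J)"
    by (rule prob_space.indep_var_lebesgue_integral[OF prob_space_jumps indep_coord])
       (use integrable_alive integral_coord(1)[of "\<lambda>k. \<beta> * exp (x * k)"] in \<open>auto simp: h\<close>)
  also have "(\<integral>v. \<beta> * exp (x * v n) \<partial>J) = 1"
    using integral_coord(2)[of "\<lambda>k. \<beta> * exp (x * k)" n] root finite_V V_nonempty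
    by (simp add: sum_distrib_left[symmetric])
  finally have "alive N n = (\<integral>v. h (pebbles v n) * (\<beta> * exp (x * v n)) \<partial>J)"
    by (simp add: h alive_def)
  \<comment> \<open>A path uncrossed at time n is either still uncrossed after the next jump or
    crosses at that very jump; on the other paths both sides vanish.\<close>
  also have "\<dots> = (\<integral>v. (if crossed N v (Suc n) then 0 else \<beta> ^ Suc n * exp (x * total v (Suc n))) +
        (if travel_time N v = Suc n then \<beta> ^ Suc n * exp (x * total v (Suc n)) else 0) \<partial>J)"
  proof (rule integral_cong_AE)
    show "AE v in J. h (pebbles v n) * (\<beta> * exp (x * v n)) =
        (if crossed N v (Suc n) then 0 else \<beta> ^ Suc n * exp (x * total v (Suc n))) +
        (if travel_time N v = Suc n then \<beta> ^ Suc n * exp (x * total v (Suc n)) else 0)"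
      using AE_bounds
    proof eventually_elim
      case (elim v)
      then have v: "\<And>i. 1 \<le> v i" by auto
      show ?case
        unfolding h travel_time_eq_Suc_iff[of v, OF v]
        using crossed_Suc[of N v n] by (auto simp: exp_add distrib_left)
    qed
  next
    show "(\<lambda>v. h (pebbles v n) * (\<beta> * exp (x * v n))) \<in> borel_measurable J"
      unfolding h by measurable
  qed measurable
  also have "\<dots> = alive N (Suc n) + stopped N (Suc n)"
    unfolding alive_def stopped_def by (rule Bochner_Integration.integral_add[OF integrable_alive integrable_stopped])
  finally show ?thesis .
qed

lemma alive_late: "alive N (2 * N + 1) = 0"
proof -
  have "alive N (2 * N + 1) = (\<integral>v. 0 \<partial>J)"
    unfolding alive_def
  proof (rule integral_cong_AE)
    show "AE v in J. (if crossed N v (2 * N + 1) then 0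
        else \<beta> ^ (2 * N + 1) * exp (x * total v (2 * N + 1))) = 0"
      using AE_bounds by eventually_elim (use crossed_late in auto)
  qed measurable
  then show ?thesis by simp
qed

text \<open>\<open>alive_step\<close> telescopes from \<open>alive N 0 = 1\<close> down to 0 at time
  2N + 1, where almost every path has crossed.\<close>

lemma sum_stopped: "(\<Sum>j=1..2 * N + 1. stopped N j) = 1"
proof -
  have "(\<Sum>j=1..n. stopped N j) = 1 - alive N n" for n
  proof (induction n)
    case (Suc n)
    then show ?case using alive_step[of N n] by simp
  qed (simp add: alive_0)
  from this[of "2 * N + 1"] show ?thesis unfolding alive_late by (rule trans) (rule diff_0_right)
qed

section \<open>From the stopped martingale to the law of the travel time\<close>

lemma travel_prob_eq: "travel_prob V N j = (\<integral>v. (if travel_time N v = j then 1 else 0) \<partial>J)"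
proof -
  have "(\<integral>v. (if travel_time N v = j then 1 else 0) \<partial>J) =
    (\<integral>v. indicat_real {v \<in> space J. travel_time N v = j} v \<partial>J)"
    by (rule Bochner_Integration.integral_cong) (auto simp: indicator_def)
  also have "\<dots> = measure J {v \<in> space J. travel_time N v = j}"
    by simp
  finally show ?thesis by (simp add: travel_prob_def)
qed

lemma integrable_travel: "integrable J (\<lambda>v. if travel_time N v = j then 1 else 0 :: real)"
  by (rule integrable_jumps_bounded[where c = 1]) auto

text \<open>On the event that the travel time is j, the total lies within \<open>b\<close> of 2N, so
  the exponential can be replaced by a constant and the integral becomes a probability.\<close>

lemma stopped_bounds:
  assumes "j \<ge> 1"
  shows "stopped N j \<le> exp (x * (2 * N + b)) * (\<beta> ^ j * travel_prob V N j)"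
    and "exp (x * (2 * real N - b)) * (\<beta> ^ j * travel_prob V N j) \<le> stopped N j"
proof -
  obtain n where j: "j = Suc n" using assms by (cases j) auto
  have bounds: "AE v in J. travel_time N v = j \<longrightarrow>
      real (total v j) \<le> 2 * N + b \<and> 2 * real N - b \<le> total v j"
    using AE_bounds
  proof eventually_elim
    case (elim v)
    then have v: "\<And>i. 1 \<le> v i" "\<And>i. v i \<le> b" by auto
    show ?case
    proof
      assume "travel_time N v = j"
      then have "total v j \<le> 2 * N + b" "2 * N \<le> total v j + b"
        using total_at_crossing[of N v n b] travel_time_eq_Suc_iff[of v N n, OF v(1)] v(2) j by auto
      then have "real (total v j) \<le> real (2 * N + b)" "real (2 * N) \<le> real (total v j + b)"
        by (simp_all only: of_nat_le_iff)
      then show "real (total v j) \<le> 2 * N + b \<and> 2 * real N - b \<le> total v j" by simp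
    qed
  qed
  have "stopped N j \<le> (\<integral>v. (\<beta> ^ j * exp (x * (2 * N + b))) * (if travel_time N v = j then 1 else 0) \<partial>J)"
    unfolding stopped_def
  proof (rule integral_mono_AE[OF integrable_stopped])
    show "AE v in J. (if travel_time N v = j then \<beta> ^ j * exp (x * total v j) else 0)
        \<le> (\<beta> ^ j * exp (x * (2 * N + b))) * (if travel_time N v = j then 1 else 0)"
      using bounds by eventually_elim (use \<beta>_pos x_pos in auto)
  qed (intro integrable_mult_right integrable_travel)
  then show "stopped N j \<le> exp (x * (2 * N + b)) * (\<beta> ^ j * travel_prob V N j)"
    by (simp add: travel_prob_eq mult_ac)
  have "(\<integral>v. (\<beta> ^ j * exp (x * (2 * real N - b))) * (if travel_time N v = j then 1 else 0) \<partial>J) \<le> stopped N j"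
    unfolding stopped_def
  proof (rule integral_mono_AE[OF _ integrable_stopped])
    show "AE v in J. (\<beta> ^ j * exp (x * (2 * real N - b))) * (if travel_time N v = j then 1 else 0)
        \<le> (if travel_time N v = j then \<beta> ^ j * exp (x * total v j) else 0)"
      using bounds by eventually_elim (use \<beta>_pos x_pos in auto)
  qed (intro integrable_mult_right integrable_travel)
  then show "exp (x * (2 * real N - b)) * (\<beta> ^ j * travel_prob V N j) \<le> stopped N j"
    by (simp add: travel_prob_eq mult_ac)
qed

text \<open>Travel times above 2N + 1 have probability 0, so this finite sum is the full
  series.\<close>

definition Pfull :: "nat \<Rightarrow> real" where
  "Pfull N = (\<Sum>j=1..2 * N + 1. \<beta> ^ (j - 1) * travel_prob V N j)"

text \<open>Summing \<open>stopped_bounds\<close> over j against the total 1 of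
  \<open>sum_stopped\<close>; the factor 1/\<beta> comes from the exponent j - 1 in place of
  j.\<close>

lemma Pfull_bounds:
  shows "exp (- x * b) / \<beta> * exp (- (2 * x) * N) \<le> Pfull N"
    and "Pfull N \<le> exp (x * b) / \<beta> * exp (- (2 * x) * N)"
proof -
  have P: "(\<Sum>j=1..2 * N + 1. \<beta> ^ j * travel_prob V N j) = \<beta> * Pfull N"
    unfolding Pfull_def sum_distrib_left
  proof (rule sum.cong)
    fix j assume "j \<in> {1..2 * N + 1}"
    then show "\<beta> ^ j * travel_prob V N j = \<beta> * (\<beta> ^ (j - 1) * travel_prob V N j)"
      by (cases j) auto
  qed simp
  have "1 \<le> exp (x * (2 * N + b)) * (\<beta> * Pfull N)"
    unfolding sum_stopped[of N, symmetric] P[symmetric] sum_distrib_left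
    by (rule sum_mono) (use stopped_bounds in auto)
  moreover have "exp (x * (2 * real N - b)) * (\<beta> * Pfull N) \<le> 1"
    unfolding sum_stopped[of N, symmetric] P[symmetric] sum_distrib_left
    by (rule sum_mono) (use stopped_bounds in auto)
  ultimately show "exp (- x * b) / \<beta> * exp (- (2 * x) * N) \<le> Pfull N"
    "Pfull N \<le> exp (x * b) / \<beta> * exp (- (2 * x) * N)"
    using \<beta>_pos by (simp_all add: exp_minus exp_diff exp_add field_simps)
qed

lemma travel_prob_eq_0:
  assumes "j \<notin> {1..2 * N + 1}"
  shows "travel_prob V N j = 0"
proof -
  have "travel_prob V N j = (\<integral>v. 0 \<partial>J)"
    unfolding travel_prob_eq
  proof (rule integral_cong_AE)
    show "AE v in J. (if travel_time N v = j then 1 else 0 :: real) = 0"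
      using AE_bounds by eventually_elim (use travel_time_bounds assms in auto)
  qed measurable
  then show ?thesis by simp
qed

lemma infsum_eq_Pfull: "(\<Sum>\<^sub>\<infinity>j\<in>{1..}. \<beta> ^ (j - 1) * travel_prob V N j) = Pfull N"
proof -
  have "(\<Sum>\<^sub>\<infinity>j\<in>{1..}. \<beta> ^ (j - 1) * travel_prob V N j) =
    (\<Sum>\<^sub>\<infinity>j\<in>{1..2 * N + 1}. \<beta> ^ (j - 1) * travel_prob V N j)"
    by (rule infsum_cong_neutral) (use travel_prob_eq_0 in auto)
  then show ?thesis by (simp add: Pfull_def)
qed

end

subsection \<open>Decay rates\<close>

text \<open>Constant factors vanish in the o(1): after taking logarithms they change the exponent by
  a bounded amount, which is O(1/N) relative to a N.\<close>

lemma decays_at_rateI: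
  assumes "a > 0" "c > 0"
    and lower: "\<forall>\<^sub>F N in sequentially. c * exp (- a * real N) \<le> P N"
    and upper: "\<forall>\<^sub>F N in sequentially. P N \<le> C * exp (- a * real N)"
  shows "decays_at_rate P a"
proof -
  \<comment> \<open>This solves P N = exp (- a N (1 + \<epsilon> N)) for \<epsilon>; the formula is
    meaningful when N > 0 and P N > 0, which holds eventually.\<close>
  define \<epsilon> where "\<epsilon> N = - ln (P N) / (a * real N) - 1" for N
  have pos: "\<forall>\<^sub>F N in sequentially. P N > 0"
    using lower by eventually_elim (use \<open>c > 0\<close> in \<open>auto intro: less_le_trans[rotated]\<close>)
  have bounds: "\<forall>\<^sub>F N in sequentially. - ln C / (a * real N) \<le> \<epsilon> N \<and> \<epsilon> N \<le> - ln c / (a * real N)"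
    using lower upper pos eventually_gt_at_top[of 0]
  proof eventually_elim
    case (elim N)
    then have "0 < C * exp (- a * real N)" by linarith
    then have "C > 0" by (simp add: zero_less_mult_iff)
    have "ln (c * exp (- a * real N)) \<le> ln (P N)" "ln (P N) \<le> ln (C * exp (- a * real N))"
      using elim \<open>c > 0\<close> \<open>C > 0\<close> by (auto intro!: ln_mono)
    then have "ln c - a * real N \<le> ln (P N)" "ln (P N) \<le> ln C - a * real N"
      using \<open>c > 0\<close> \<open>C > 0\<close> by (auto simp: ln_mult)
    then have bounds: "- ln C \<le> - ln (P N) - a * real N" "- ln (P N) - a * real N \<le> - ln c"
      by linarith+
    have "0 \<le> a * real N" using \<open>a > 0\<close> by simp
    note divide_right_mono[OF bounds(1) this] divide_right_mono[OF bounds(2) this]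
    moreover have "(- ln (P N) - a * real N) / (a * real N) = \<epsilon> N"
      using \<open>a > 0\<close> elim by (simp add: \<epsilon>_def diff_divide_distrib)
    ultimately show ?case by simp
  qed
  have lim: "(\<lambda>N. - ln C / (a * real N)) \<longlonglongrightarrow> 0" "(\<lambda>N. - ln c / (a * real N)) \<longlonglongrightarrow> 0"
    using \<open>a > 0\<close> by real_asymp+
  have "\<epsilon> \<longlonglongrightarrow> 0"
    by (rule tendsto_sandwich[OF _ _ lim]; rule eventually_mono[OF bounds]) auto
  moreover have "\<forall>\<^sub>F N in sequentially. P N = exp (- a * real N * (1 + \<epsilon> N))"
    using pos eventually_gt_at_top[of 0]
  proof eventually_elim
    case (elim N)
    then have "- a * real N * (1 + \<epsilon> N) = ln (P N)"
      using \<open>a > 0\<close> by (simp add: \<epsilon>_def)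
    then show ?case using elim by simp
  qed
  ultimately show ?thesis unfolding decays_at_rate_def by blast
qed

section \<open>Rates of the full and the truncated sums\<close>

context leapfrog
begin

lemma decays_Pfull: "decays_at_rate Pfull (2 * x)"
proof (rule decays_at_rateI)
  show "2 * x > 0" using x_pos by simp
  show "exp (- x * b) / \<beta> > 0" using \<beta>_pos by simp
qed (rule always_eventually, rule allI, rule Pfull_bounds)+

text \<open>If the mean jump is at least 2, the root condition forces \<open>\<beta>\<close> strictly below
  \<open>exp (- 2 * x)\<close> (Jensen), so that travel times beyond \<open>N\<close> are exponentially negligible.\<close>

lemma \<beta>_exp_less_1:
  assumes mean: "(\<Sum>v\<in>V. real v) \<ge> 2 * real (card V)" and "u \<in> V" "u > 2"
  shows "\<beta> * exp (2 * x) < 1"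
proof -
  \<comment> \<open>The summands are the tangent line of exp at 0, evaluated at x (v - 2); the
    hypothesis on the mean makes their sum at least \<open>card V\<close>.\<close>
  have "(\<Sum>v\<in>V. 1 + x * (real v - 2)) = real (card V) + x * ((\<Sum>v\<in>V. real v) - 2 * real (card V))"
    by (simp only: sum.distrib sum_distrib_left[symmetric] sum_subtractf) simp
  moreover have "0 \<le> x * ((\<Sum>v\<in>V. real v) - 2 * real (card V))"
    using mean x_pos by simp
  ultimately have "real (card V) \<le> (\<Sum>v\<in>V. 1 + x * (real v - 2))" by linarith
  also have "\<dots> < (\<Sum>v\<in>V. exp (x * (real v - 2)))"
  proof (rule sum_strict_mono_ex1[OF finite_V])
    show "\<forall>v\<in>V. 1 + x * (real v - 2) \<le> exp (x * (real v - 2))"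
      using exp_ge_add_one_self by blast
    \<comment> \<open>A jump above 2 makes the inequality strict, since the quadratic Taylor term is
      positive there.\<close>
    have y: "0 < x * (real u - 2)" using assms x_pos by simp
    with half_gt_zero[OF zero_less_power[OF y, of 2]] exp_lower_Taylor_quadratic[of "x * (real u - 2)"]
    have "1 + x * (real u - 2) < exp (x * (real u - 2))" by linarith
    with \<open>u \<in> V\<close> show "\<exists>v\<in>V. 1 + x * (real v - 2) < exp (x * (real v - 2))" by blast
  qed
  finally have less: "real (card V) < (\<Sum>v\<in>V. exp (x * (real v - 2)))" .
  have shift: "exp (2 * x) * exp (x * (real v - 2)) = exp (x * real v)" for v :: nat
    unfolding exp_add[symmetric] by (simp add: algebra_simps)
  have "\<beta> * exp (2 * x) * real (card V) < \<beta> * exp (2 * x) * (\<Sum>v\<in>V. exp (x * (real v - 2)))"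
    using less \<beta>_pos by simp
  also have "\<dots> = \<beta> * (\<Sum>v\<in>V. exp (x * real v))"
    by (simp only: mult.assoc sum_distrib_left shift)
  also have "\<dots> = 1 * real (card V)" using root by simp
  finally show ?thesis by (rule mult_right_less_imp_less) simp
qed

lemma decays_truncated:
  assumes q: "\<beta> * exp (2 * x) < 1"
  shows "decays_at_rate (\<lambda>N. \<Sum>j=1..N. \<beta> ^ (j - 1) * travel_prob V N j) (2 * x)"
proof (rule decays_at_rateI)
  define c where "c = exp (- x * b) / \<beta>"
  have nonneg: "0 \<le> \<beta> ^ (j - 1) * travel_prob V N j" for j N
    using \<beta>_pos by (simp add: travel_prob_def)
  have split: "Pfull N = (\<Sum>j=1..N. \<beta> ^ (j - 1) * travel_prob V N j) +
      (\<Sum>j=N + 1..2 * N + 1. \<beta> ^ (j - 1) * travel_prob V N j)" for N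
  proof -
    have "{1..2 * N + 1} = {1..N} \<union> {N + 1..2 * N + 1}" by auto
    then show ?thesis unfolding Pfull_def by (simp only:) (rule sum.union_disjoint, auto)
  qed
  show "2 * x > 0" using x_pos by simp
  \<comment> \<open>\<open>c\<close> is the constant in the lower bound for \<open>Pfull\<close>;
    half of it absorbs the discarded tail.\<close>
  show "c / 2 > 0" using \<beta>_pos by (simp add: c_def)
  show "\<forall>\<^sub>F N in sequentially. (\<Sum>j=1..N. \<beta> ^ (j - 1) * travel_prob V N j)
      \<le> exp (x * b) / \<beta> * exp (- (2 * x) * real N)"
  proof (rule always_eventually, rule allI)
    fix N
    show "(\<Sum>j=1..N. \<beta> ^ (j - 1) * travel_prob V N j) \<le> exp (x * b) / \<beta> * exp (- (2 * x) * real N)"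
    proof -
      have "0 \<le> (\<Sum>j=N + 1..2 * N + 1. \<beta> ^ (j - 1) * travel_prob V N j)"
        by (rule sum_nonneg) (rule nonneg)
      then show ?thesis using Pfull_bounds(2)[of N] split[of N] by linarith
    qed
  qed
  \<comment> \<open>This is the bound (N + 1) \<beta>^N for the tail, divided by exp (- 2 x
    N).\<close>
  have "(\<lambda>N. (1 + real N) * (\<beta> * exp (2 * x)) ^ N) \<longlonglongrightarrow> 0"
    using q \<beta>_pos by (simp add: distrib_right)
      (intro tendsto_add_zero powser_times_n_limit_0 LIMSEQ_realpow_zero, auto)
  then have "\<forall>\<^sub>F N in sequentially. (1 + real N) * (\<beta> * exp (2 * x)) ^ N < c / 2"
    by (rule order_tendstoD) (rule \<open>c / 2 > 0\<close>)
  then show "\<forall>\<^sub>F N in sequentially. c / 2 * exp (- (2 * x) * real N)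
      \<le> (\<Sum>j=1..N. \<beta> ^ (j - 1) * travel_prob V N j)"
  proof eventually_elim
    case (elim N)
    have "(\<Sum>j=N + 1..2 * N + 1. \<beta> ^ (j - 1) * travel_prob V N j)
        \<le> (\<Sum>j=N + 1..2 * N + 1. \<beta> ^ N * 1)"
    proof (rule sum_mono, rule mult_mono)
      fix j assume "j \<in> {N + 1..2 * N + 1}"
      then show "\<beta> ^ (j - 1) \<le> \<beta> ^ N"
        using \<beta>_pos \<beta>_less by (intro power_decreasing) auto
      show "travel_prob V N j \<le> 1"
        unfolding travel_prob_def by (rule prob_space.prob_le_1[OF prob_space_jumps])
    qed (use \<beta>_pos in \<open>auto simp: travel_prob_def\<close>)
    also have "\<dots> = (1 + real N) * (\<beta> * exp (2 * x)) ^ N * exp (- (2 * x) * real N)"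
    proof -
      have "exp (2 * x) ^ N * exp (- (2 * x) * real N) = 1"
        by (simp add: exp_of_nat_mult[symmetric] exp_add[symmetric])
      then have "\<beta> ^ N = (\<beta> * exp (2 * x)) ^ N * exp (- (2 * x) * real N)"
        by (simp only: power_mult_distrib mult.assoc mult_1_right)
      then show ?thesis by simp
    qed
    also have "\<dots> \<le> c / 2 * exp (- (2 * x) * real N)"
      using elim by (intro mult_right_mono) auto
    finally show ?case
      using Pfull_bounds(1)[of N] split[of N] by (simp add: c_def)
  qed
qed

end

section \<open>The two chains as instances\<close>

lemma leapfrog_minus:
  assumes "B \<ge> 2"
  shows "leapfrog (jump_sizes_minus B) B (1 - 1 / real B) (expsum_root 0 B)"
proof
  have "(\<Sum>v\<in>jump_sizes_minus B. exp (expsum_root 0 B * real v)) = real B"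
    using expsum_root[of B 0] assms by (simp add: expsum_def jump_sizes_minus_def mult.commute)
  \<comment> \<open>There are B - 1 jump sizes, and (1 - 1/B) B = B - 1.\<close>
  then show "(1 - 1 / real B) * (\<Sum>v\<in>jump_sizes_minus B. exp (expsum_root 0 B * real v)) =
      real (card (jump_sizes_minus B))"
    using assms by (simp add: jump_sizes_minus_def left_diff_distrib of_nat_diff)
qed (use assms expsum_root_pos in \<open>auto simp: jump_sizes_minus_def field_simps\<close>)

lemma leapfrog_plus:
  assumes "B \<ge> 2"
  shows "leapfrog (jump_sizes_plus B) B (1 - 1 / real B) (expsum_root 1 B)"
proof
  \<comment> \<open>The jump v corresponds to the index i = v - 1 in the root equation.\<close>
  have V: "{2..B} = {Suc 1..Suc (B - 1)}" using assms by auto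
  have "(\<Sum>v\<in>jump_sizes_plus B. exp (expsum_root 1 B * real v)) = expsum 1 B (expsum_root 1 B)"
    unfolding jump_sizes_plus_def V sum.shift_bounds_cl_Suc_ivl expsum_def
    by (simp add: mult.commute add.commute)
  also have "\<dots> = real B"
    using assms by (simp add: expsum_root)
  finally show "(1 - 1 / real B) * (\<Sum>v\<in>jump_sizes_plus B. exp (expsum_root 1 B * real v)) =
      real (card (jump_sizes_plus B))"
    using assms by (simp add: jump_sizes_plus_def left_diff_distrib of_nat_diff)
qed (use assms expsum_root_pos in \<open>auto simp: jump_sizes_plus_def field_simps\<close>)

theorem theorem4p2:
  shows "(\<forall>B\<ge>2. (\<exists>!\<alpha>. is_root_minus B \<alpha>) \<and> (\<exists>!\<alpha>. is_root_plus B \<alpha>)) \<and>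
    (\<forall>B\<ge>2. decays_at_rate (P_minus_full B) (alpha_minus B) \<and>
            decays_at_rate (P_plus_full B) (alpha_plus B)) \<and>
    (\<forall>B\<ge>4. decays_at_rate (P_minus B) (alpha_minus B)) \<and>
    (\<forall>B\<ge>3. decays_at_rate (P_plus B) (alpha_plus B)) \<and>
    (\<lambda>B. alpha_plus B - (4 / real B ^ 2 - (20 / 3) / real B ^ 3)) \<in> O(\<lambda>B. 1 / real B ^ 4) \<and>
    (\<lambda>B. alpha_minus B - (4 / real B ^ 2 + (4 / 3) / real B ^ 3)) \<in> O(\<lambda>B. 1 / real B ^ 4)"
proof (intro conjI allI impI alpha_minus_asymp alpha_plus_asymp)
  fix B :: nat
  show "\<exists>!\<alpha>. is_root_minus B \<alpha>" "\<exists>!\<alpha>. is_root_plus B \<alpha>" if "B \<ge> 2"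
    using that by (simp_all add: is_root_minus_iff is_root_plus_iff expsum_root_ex1)
  show "decays_at_rate (P_minus_full B) (alpha_minus B)" if "B \<ge> 2"
    using leapfrog.decays_Pfull[OF leapfrog_minus[OF that]]
    unfolding leapfrog.infsum_eq_Pfull[OF leapfrog_minus[OF that], symmetric, abs_def]
      P_minus_full_def[abs_def] alpha_minus_eq .
  show "decays_at_rate (P_plus_full B) (alpha_plus B)" if "B \<ge> 2"
    using leapfrog.decays_Pfull[OF leapfrog_plus[OF that]]
    unfolding leapfrog.infsum_eq_Pfull[OF leapfrog_plus[OF that], symmetric, abs_def]
      P_plus_full_def[abs_def] alpha_plus_eq .
  show "decays_at_rate (P_minus B) (alpha_minus B)" if "B \<ge> 4"
  proof -
    have leapfrog: "leapfrog (jump_sizes_minus B) B (1 - 1 / real B) (expsum_root 0 B)"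
      by (rule leapfrog_minus) (use that in simp)
    \<comment> \<open>The mean jump is B/2, which is at least 2 because B is at least 4; then 3 is
      also an admissible jump.\<close>
    have "2 * (\<Sum>v=1..B - 1. real v) = real (B - 1) * (real (B - 1) + 1)"
      using double_gauss_sum_from_Suc_0[of "B - 1", where 'a = real] by simp
    also have "\<dots> \<ge> real (B - 1) * 4"
      by (rule mult_left_mono) (use that in auto)
    finally have "2 * real (card (jump_sizes_minus B)) \<le> (\<Sum>v\<in>jump_sizes_minus B. real v)"
      by (simp add: jump_sizes_minus_def)
    then have "(1 - 1 / real B) * exp (2 * expsum_root 0 B) < 1"
      by (rule leapfrog.\<beta>_exp_less_1[OF leapfrog, of 3])
         (use that in \<open>auto simp: jump_sizes_minus_def\<close>)
    from leapfrog.decays_truncated[OF leapfrog this] show ?thesis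
      unfolding P_minus_def[abs_def] alpha_minus_eq .
  qed
  show "decays_at_rate (P_plus B) (alpha_plus B)" if "B \<ge> 3"
  proof -
    have leapfrog: "leapfrog (jump_sizes_plus B) B (1 - 1 / real B) (expsum_root 1 B)"
      by (rule leapfrog_plus) (use that in simp)
    \<comment> \<open>Every jump is at least 2, and 3 is admissible once B is at least 3.\<close>
    have "real (card (jump_sizes_plus B)) * 2 \<le> (\<Sum>v\<in>jump_sizes_plus B. real v)"
      by (rule sum_bounded_below) (auto simp: jump_sizes_plus_def)
    then have "(1 - 1 / real B) * exp (2 * expsum_root 1 B) < 1"
      by (intro leapfrog.\<beta>_exp_less_1[OF leapfrog, of 3])
         (use that in \<open>auto simp: jump_sizes_plus_def\<close>)
    from leapfrog.decays_truncated[OF leapfrog this] show ?thesis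
      unfolding P_plus_def[abs_def] alpha_plus_eq .
  qed
qed

end
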